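(* Let $p$ be a fixed odd prime, let $q\in\mathbb{C}_p$ with $|q-1|_p<1$, and let the $q$-Euler numbers $\widetilde{E}_{n,q}$ ($n\ge 0$) be defined by $$\frac{[2]_q}{qe^{t}+1}=\sum_{n=0}^{\infty}\widetilde{E}_{n,q}\frac{t^n}{n!},\qquad [2]_q=1+q.$$ Then for all natural numbers $k,m$, $$\sum_{j=1}^{\max\{k,m\}}\left[q\binom{k}{j}+(-1)^j\binom{m}{j}\right]\frac{\widetilde{E}_{k+m-j+1,q}}{k+m-j+1} = q\,\frac{(-1)^{m+1}}{(k+m+1)\binom{k+m}{k}}-[2]_q\,\frac{\widetilde{E}_{k+m+1,q}}{k+m+1}.$$
   Context: $\mathbb{C}_p$ is the completion of an algebraic closure of $\mathbb{Q}_p$, and $|\cdot|_p$ is the $p$-adic absolute value with $|p|_p=1/p$. The generating function is understood as a formal power series in $t$. Binomial coefficients $\binom{a}{j}$ with $j>a\ge 0$ are taken to be $0$. Equivalently, $\widetilde{E}_{n,q}=\int_{\mathbb{Z}_p}y^n\,d\mu_{-q}(y)$ for Kim's fermionic $p$-adic $q$-integral. *)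

theory Defs
  imports
    "HOL-Analysis.Analysis"
    "HOL-Algebra.Algebraic_Closure_Type"
begin

definition padic_abs_rat :: "nat \<Rightarrow> rat \<Rightarrow> real" where
  "padic_abs_rat p r =
     (if r = 0 then 0
      else case quotient_of r of (a, b) \<Rightarrow>
        real p powi (int (multiplicity (int p) b) - int (multiplicity (int p) a)))"

definition nonarch_abs :: "('a::field \<Rightarrow> real) \<Rightarrow> bool" where
  "nonarch_abs v \<longleftrightarrow>
     (\<forall>x. 0 \<le> v x) \<and> (\<forall>x. v x = 0 \<longleftrightarrow> x = 0) \<and>
     (\<forall>x y. v (x * y) = v x * v y) \<and> (\<forall>x y. v (x + y) \<le> max (v x) (v y))"

definition completion_within :: "('a::field \<Rightarrow> real) \<Rightarrow> 'a set \<Rightarrow> 'a set \<Rightarrow> bool" where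
  "completion_within v A S \<longleftrightarrow>
     A \<subseteq> S \<and>
     Metric_space.mcomplete S (\<lambda>x y. v (x - y)) \<and>
     Metric_space.mtopology S (\<lambda>x y. v (x - y)) closure_of A = S"

text \<open>
  The type \<open>'a\<close> with the absolute value \<open>v\<close> is a copy of the field of \<open>p\<close>-adic complex numbers:
  \<open>K\<close> is the field of \<open>p\<close>-adic numbers (the completion of the rationals), \<open>L\<close> is an algebraic
  closure of \<open>K\<close>, and the whole type is the completion of \<open>L\<close>.  This determines \<open>('a, v)\<close> up to
  isometric field isomorphism.
\<close>

definition is_padic_complex :: "nat \<Rightarrow> ('a::field_char_0 \<Rightarrow> real) \<Rightarrow> bool" where
  "is_padic_complex p v \<longleftrightarrow>
     nonarch_abs v \<and>
     (\<forall>r. v (of_rat r) = padic_abs_rat p r) \<and>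
     (\<exists>K L. completion_within v \<rat> K \<and>
            algebraic_closure (ring_of_type_algebra\<lparr>carrier := L\<rparr>) K \<and>
            completion_within v L UNIV)"

definition q_Euler :: "'a::field_char_0 \<Rightarrow> nat \<Rightarrow> 'a" where
  "q_Euler q n = fact n * fps_nth (fps_const (1 + q) / (fps_const q * fps_exp 1 + 1)) n"

lemma q_Euler_gen_fun:
  "fps_const (1 + q) / (fps_const q * fps_exp 1 + 1) = Abs_fps (\<lambda>n. q_Euler q n / fact n)"
  by (rule fps_ext) (simp add: q_Euler_def)

lemma padic_abs_rat_p:
  assumes "Factorial_Ring.prime p"
  shows "padic_abs_rat p (of_nat p) = 1 / real p"
proof -
  have "p \<noteq> 0" "Factorial_Ring.prime (int p)" using assms by auto
  moreover have "multiplicity (int p) (int p) = 1"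
    using \<open>Factorial_Ring.prime (int p)\<close> by (intro multiplicity_prime) auto
  moreover have "quotient_of (of_nat p) = (int p, 1)"
    using quotient_of_int[of "int p"] by (simp add: of_int_def)
  ultimately show ?thesis
    by (simp add: padic_abs_rat_def power_int_minus field_simps)
qed

text \<open>
  The hypothesis on \<open>q\<close> makes the denominator of the generating function a unit.
\<close>

lemma one_plus_q_nonzero:
  fixes v :: "'a::field_char_0 \<Rightarrow> real"
  assumes p: "Factorial_Ring.prime p" "odd p" and v: "is_padic_complex p v" and q: "v (q - 1) < 1"
  shows "1 + q \<noteq> 0"
proof
  assume "1 + q = 0"
  hence "q = -1" by (simp add: add_eq_0_iff)
  hence eq: "q - 1 = of_rat (-2)" by (simp add: of_rat_minus)
  have "\<not> int p dvd 2"
  proof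
    assume "int p dvd 2"
    hence "p dvd 2" by presburger
    with p have "p = 2" using primes_dvd_imp_eq two_is_prime_nat by blast
    with p show False by simp
  qed
  hence "multiplicity (int p) (-2) = 0" by (simp add: not_dvd_imp_multiplicity_0)
  moreover have "quotient_of (-2) = (-2, 1)"
    using quotient_of_int[of "-2"] by simp
  ultimately have "padic_abs_rat p (-2) = 1" by (simp add: padic_abs_rat_def)
  with v have "v (q - 1) = 1" unfolding eq is_padic_complex_def by metis
  with q show False by simp
qed

end

theory Submission
  imports Defs
begin

text \<open>
  Let \<open>\<phi>\<close> be the linear functional on polynomials with \<open>\<phi>(x^n) = E_n\<close>.  The generating function
  says that \<open>q \<phi>(f(x+1)) + \<phi>(f) = (1 + q) f(0)\<close> for every polynomial \<open>f\<close>.  Apply this to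
  \<open>G(x)\<close>, the integral of \<open>y^k (y-1)^m\<close> from 0 to \<open>x\<close>.  Then \<open>G(x+1) = F(x) + G(1)\<close>, where
  \<open>F(x)\<close> is the integral of \<open>(1+y)^k y^m\<close> from 0 to \<open>x\<close>, and \<open>G(1)\<close> is, up to sign, the Beta
  integral.  Expanding \<open>q \<phi>(F) + \<phi>(G)\<close> by the binomial theorem gives the sum over \<open>j\<close>,
  completed by its term for \<open>j = 0\<close>.
\<close>

hide_const (open) up_ring.coeff up_ring.monom Polynomials.degree Module.smult

definition umbral :: "(nat \<Rightarrow> 'a) \<Rightarrow> 'a poly \<Rightarrow> 'a::comm_ring_1" where
  "umbral e f = (\<Sum>i\<le>degree f. coeff f i * e i)"

text \<open>Coefficients beyond the degree vanish, so polynomials of different degrees can share one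
  bound \<open>N\<close>; additivity rests on this.\<close>

lemma umbral_eq_sum:
  assumes "degree f \<le> N"
  shows "umbral e f = (\<Sum>i\<le>N. coeff f i * e i)"
  unfolding umbral_def using assms
  by (intro sum.mono_neutral_left) (auto simp: not_le coeff_eq_0)

lemma umbral_0 [simp]: "umbral e 0 = 0"
  by (simp add: umbral_def)

lemma umbral_add: "umbral e (f + g) = umbral e f + umbral e g"
proof -
  define N where "N = max (degree f) (degree g)"
  have "degree (f + g) \<le> N" "degree f \<le> N" "degree g \<le> N"
    by (auto simp: N_def intro: degree_add_le_max)
  thus ?thesis
    by (simp add: umbral_eq_sum ring_distribs sum.distrib)
qed

lemma umbral_sum: "umbral e (\<Sum>i\<in>A. f i) = (\<Sum>i\<in>A. umbral e (f i))"
  by (induction A rule: infinite_finite_induct) (simp_all add: umbral_add)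

lemma umbral_smult: "umbral e (smult c f) = c * umbral e f"
  by (subst umbral_eq_sum[of _ "degree f"])
    (auto simp: umbral_def sum_distrib_left mult_ac degree_smult_le)

lemma umbral_monom [simp]: "umbral e (monom c n) = c * e n"
  by (subst umbral_eq_sum[of _ n])
    (auto simp: degree_monom_le if_distrib[of "\<lambda>x. x * _"] cong: if_cong)

lemma umbral_const [simp]: "umbral e [:c:] = c * e 0"
  by (simp add: umbral_def)

lemma shift_power: "[:1, 1::'a::comm_ring_1:] ^ n = (\<Sum>i\<le>n. monom (of_nat (n choose i)) i)"
proof -
  have "[:1, 1::'a:] ^ n = ([:0, 1:] + 1) ^ n"
    by (simp add: one_pCons)
  also have "\<dots> = (\<Sum>i\<le>n. monom (of_nat (n choose i)) i)"
    by (subst binomial_ring)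
      (auto intro!: sum.cong simp: monom_altdef of_nat_poly)
  finally show ?thesis .
qed

lemma pcompose_power: "pcompose (f ^ n) g = pcompose f g ^ n"
  by (induction n) (simp_all add: pcompose_mult pcompose_1)

text \<open>Compare the coefficients of t^n / n! in the generating function times its denominator
  \<open>den\<close>; the constant term \<open>1 + q\<close> of \<open>den\<close> makes it a
  unit.\<close>

lemma q_Euler_binomial_recurrence:
  fixes q :: "'a::field_char_0"
  assumes "1 + q \<noteq> 0"
  shows "q * (\<Sum>i\<le>n. of_nat (n choose i) * q_Euler q i) + q_Euler q n
         = (if n = 0 then 1 + q else 0)"
proof -
  define den where "den = fps_const q * fps_exp (1::'a) + 1"
  define gf where "gf = fps_const (1 + q) / den"
  have "fps_nth den 0 \<noteq> 0"
    using assms by (simp add: den_def add.commute)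
  hence "gf * den = fps_const (1 + q)"
    by (simp add: gf_def fps_divide_unit inverse_mult_eq_1 mult.assoc)
  hence "fact n * fps_nth (fps_const q * (gf * fps_exp 1) + gf) n
         = fact n * fps_nth (fps_const (1 + q)) n"
    by (simp add: den_def algebra_simps)
  moreover have "fact n * fps_nth (gf * fps_exp 1) n
      = (\<Sum>i\<le>n. of_nat (n choose i) * q_Euler q i)"
    unfolding fps_mult_nth atLeast0AtMost sum_distrib_left
    by (intro sum.cong) (auto simp: q_Euler_def gf_def den_def binomial_fact)
  ultimately show ?thesis
    by (simp add: q_Euler_def gf_def den_def algebra_simps split: if_splits)
qed

lemma umbral_q_Euler_shift:
  fixes q :: "'a::field_char_0"
  assumes "1 + q \<noteq> 0"
  shows "q * umbral (q_Euler q) (pcompose f [:1, 1:]) + umbral (q_Euler q) f = (1 + q) * poly f 0"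
proof -
  let ?\<phi> = "umbral (q_Euler q)"
  \<comment> \<open>By linearity monomials suffice; for these (x + 1)^n expands into the sum of the
    recurrence, and \<open>0 ^ 0 = 1\<close> covers its case n = 0.\<close>
  have power: "q * ?\<phi> (pcompose (monom 1 n) [:1, 1:]) + ?\<phi> (monom 1 n) = (1 + q) * 0 ^ n" for n
  proof -
    have "pcompose (monom 1 n) [:1, 1:] = [:1, 1::'a:] ^ n"
      by (simp add: monom_altdef pcompose_power pcompose_pCons)
    thus ?thesis
      using q_Euler_binomial_recurrence[OF assms, of n] by (auto simp: shift_power umbral_sum)
  qed
  have f: "f = (\<Sum>i\<le>degree f. smult (coeff f i) (monom 1 i))"
    by (simp add: smult_monom poly_as_sum_of_monoms)
  have "q * ?\<phi> (pcompose f [:1, 1:]) + ?\<phi> f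
      = (\<Sum>i\<le>degree f. coeff f i * (q * ?\<phi> (pcompose (monom 1 i) [:1, 1:]) + ?\<phi> (monom 1 i)))"
    by (subst (1 2) f, unfold pcompose_sum pcompose_smult umbral_sum umbral_smult)
      (simp add: sum_distrib_left sum.distrib algebra_simps)
  also have "\<dots> = (1 + q) * poly f 0"
    unfolding power poly_altdef by (simp only: sum_distrib_left mult_ac)
  finally show ?thesis .
qed

text \<open>In characteristic 0 only constants have zero derivative; the constant is read off at
  0.\<close>

lemma poly_eq_const_if_pderiv_eq:
  fixes f g :: "'a::field_char_0 poly"
  assumes "pderiv f = pderiv g"
  shows "f = g + [:poly f 0 - poly g 0:]"
proof -
  have "pderiv (f - g) = 0"
    using assms by (simp add: pderiv_diff)
  then obtain h where "f - g = [:h:]"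
    using pderiv_iszero by blast
  hence "f = g + [:h:]"
    by (simp add: algebra_simps)
  thus ?thesis by simp
qed

text \<open>The integral of (c + y)^k y^m from 0 to x, expanded in powers of c. The arguments
  \<open>1 k m\<close> give F, and \<open>(-1) m k\<close> give G.\<close>

definition binomial_antideriv :: "'a \<Rightarrow> nat \<Rightarrow> nat \<Rightarrow> 'a::field_char_0 poly" where
  "binomial_antideriv c k m =
     (\<Sum>j\<le>k. monom (c ^ j * of_nat (k choose j) / of_nat (k + m - j + 1)) (k + m - j + 1))"

lemma pderiv_binomial_antideriv:
  "pderiv (binomial_antideriv c k m) = [:c, 1:] ^ k * [:0, 1:] ^ m"
proof -
  have "pderiv (binomial_antideriv c k m)
      = (\<Sum>j\<le>k. monom (c ^ j * of_nat (k choose j)) (k + m - j))"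
    unfolding binomial_antideriv_def
    by (simp add: higher_pderiv_sum[of 1, simplified] pderiv_monom del: of_nat_Suc)
  also have "\<dots> = (\<Sum>j\<le>k. of_nat (k choose j) * [:c:] ^ j * [:0, 1:] ^ (k - j)) * [:0, 1:] ^ m"
    unfolding sum_distrib_right
    by (intro sum.cong)
      (auto simp: monom_altdef of_nat_poly poly_const_pow power_add[symmetric]
        mult.assoc mult.commute add.commute)
  also have "\<dots> = ([:c:] + [:0, 1:]) ^ k * [:0, 1:] ^ m"
    by (subst binomial_ring) simp
  finally show ?thesis by simp
qed

lemma poly_binomial_antideriv_0 [simp]: "poly (binomial_antideriv c k m) 0 = 0"
  by (simp add: binomial_antideriv_def poly_sum poly_monom)

text \<open>Vanishing binomials pad the sum, so that those for F and G, ending at k and m, can both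
  run up to \<open>max k m\<close>.\<close>

lemma umbral_binomial_antideriv:
  assumes "k \<le> N"
  shows "umbral e (binomial_antideriv c k m)
    = (\<Sum>j\<le>N. c ^ j * of_nat (k choose j) * (e (k + m - j + 1) / of_nat (k + m - j + 1)))"
proof -
  have "umbral e (binomial_antideriv c k m)
    = (\<Sum>j\<le>k. c ^ j * of_nat (k choose j) * (e (k + m - j + 1) / of_nat (k + m - j + 1)))"
    by (simp add: binomial_antideriv_def umbral_sum)
  also have "\<dots> = (\<Sum>j\<le>N. c ^ j * of_nat (k choose j) * (e (k + m - j + 1) / of_nat (k + m - j + 1)))"
    using assms by (intro sum.mono_neutral_left) auto
  finally show ?thesis .
qed

text \<open>The value at 1 of the antiderivative of \<open>(y-1)^m y^k\<close> is found by integration by parts.\<close>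

lemma poly_binomial_antideriv_Suc:
  "of_nat (Suc k) * poly (binomial_antideriv (-1) (Suc m) k) 1
   = - of_nat (Suc m) * poly (binomial_antideriv (-1) m (Suc k)) (1::'a::field_char_0)"
proof -
  define f :: "'a poly" where "f = smult (of_nat (Suc k)) (binomial_antideriv (-1) (Suc m) k)
    + smult (of_nat (Suc m)) (binomial_antideriv (-1) m (Suc k))"
  \<comment> \<open>Product rule: \<open>f\<close> and (x - 1)^(m + 1) x^(k + 1) have the same
    derivative and both vanish at 0; the latter also vanishes at 1.\<close>
  have "pderiv f = pderiv ([:-1, 1:] ^ Suc m * [:0, 1:] ^ Suc k)"
    unfolding f_def pderiv_add pderiv_smult pderiv_binomial_antideriv pderiv_mult pderiv_power_Suc
    by (simp add: pderiv_pCons mult.commute del: of_nat_Suc)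
  from poly_eq_const_if_pderiv_eq[OF this]
  have "f = [:-1, 1:] ^ Suc m * [:0, 1:] ^ Suc k"
    by (simp add: f_def)
  hence "poly f 1 = 0" by simp
  thus ?thesis by (simp add: f_def algebra_simps add_eq_0_iff)
qed

lemma poly_binomial_antideriv_1:
  "poly (binomial_antideriv (-1) m k) 1
   = (-1) ^ m / (of_nat (k + m + 1) * of_nat ((k + m) choose k) :: 'a::field_char_0)"
proof -
  have "poly (binomial_antideriv (-1) m k) 1
      = (-1) ^ m * fact k * fact m / (fact (k + m + 1) :: 'a)"
  \<comment> \<open>\<open>k\<close> varies because each integration by parts trades a factor y - 1
    for a factor y.\<close>
  proof (induction m arbitrary: k)
    case 0
    show ?case by (simp add: binomial_antideriv_def poly_monom)
  next
    case (Suc m)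
    have "poly (binomial_antideriv (-1) (Suc m) k) 1
        = - of_nat (Suc m) * poly (binomial_antideriv (-1) m (Suc k)) (1::'a) / of_nat (Suc k)"
      unfolding poly_binomial_antideriv_Suc[symmetric] by (simp del: of_nat_Suc)
    thus ?case
      unfolding Suc by (simp add: divide_simps del: of_nat_Suc)
  qed
  thus ?thesis by (simp add: binomial_fact field_simps)
qed

theorem theorem1:
  fixes p :: nat and v :: "'a::field_char_0 \<Rightarrow> real" and q :: 'a and k m :: nat
  assumes "Factorial_Ring.prime p" and "odd p"
    and "is_padic_complex p v"
    and "v (q - 1) < 1"
  shows "(\<Sum>j = 1..max k m.
            (q * of_nat (k choose j) + (-1) ^ j * of_nat (m choose j)) *
            (q_Euler q (k + m - j + 1) / of_nat (k + m - j + 1)))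
         = q * ((-1) ^ (m + 1) / (of_nat (k + m + 1) * of_nat ((k + m) choose k)))
           - (1 + q) * (q_Euler q (k + m + 1) / of_nat (k + m + 1))"
proof -
  have q: "1 + q \<noteq> 0"
    using one_plus_q_nonzero assms by blast
  define F :: "'a poly" where "F = binomial_antideriv 1 k m"
  define G :: "'a poly" where "G = binomial_antideriv (-1) m k"
  let ?\<phi> = "umbral (q_Euler q)"
  let ?t = "\<lambda>j. (q * of_nat (k choose j) + (-1) ^ j * of_nat (m choose j)) *
            (q_Euler q (k + m - j + 1) / of_nat (k + m - j + 1))"
  \<comment> \<open>The shift turns (y - 1)^m y^k into y^m (y + 1)^k, so G(x + 1) and F(x) differ by
    the constant G(1).\<close>
  have "pderiv (pcompose G [:1, 1:]) = pderiv F"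
    by (simp add: pderiv_pcompose G_def F_def pderiv_binomial_antideriv pcompose_mult
        pcompose_power pcompose_pCons pderiv_pCons mult.commute)
  from poly_eq_const_if_pderiv_eq[OF this] have "pcompose G [:1, 1:] = F + [:poly G 1:]"
    by (simp add: F_def poly_pcompose)
  \<comment> \<open>\<phi> sends the constant G(1) to G(1) E_0, hence the normalisation E_0 =
    1.\<close>
  moreover have "(1 + q) * q_Euler q 0 = (1 + q) * 1"
    using q_Euler_binomial_recurrence[OF q, of 0] by (simp add: algebra_simps)
  hence "q_Euler q 0 = 1"
    using q mult_left_cancel by blast
  ultimately have *: "q * ?\<phi> F + ?\<phi> G = - q * poly G 1"
    using umbral_q_Euler_shift[OF q, of G]
    by (simp add: umbral_add G_def eq_neg_iff_add_eq_0) (simp add: algebra_simps)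
  have "q * ?\<phi> F + ?\<phi> G = (\<Sum>j\<le>max k m. ?t j)"
    unfolding F_def G_def
    by (subst (1 2) umbral_binomial_antideriv[where N = "max k m"])
      (auto simp: sum_distrib_left sum.distrib algebra_simps add_divide_distrib)
  \<comment> \<open>Both binomials are 1 at j = 0, so \<open>?t 0\<close> is the term subtracted on
    the right of the claim.\<close>
  also have "\<dots> = ?t 0 + (\<Sum>j = 1..max k m. ?t j)"
    by (simp only: atMost_atLeast0 sum.atLeast_Suc_atMost[OF le0] One_nat_def)
  finally have "(\<Sum>j = 1..max k m. ?t j) = - q * poly G 1 - ?t 0"
    unfolding * by (simp only: eq_diff_eq add.commute)
  also have "\<dots> = q * ((-1) ^ (m + 1) / (of_nat (k + m + 1) * of_nat ((k + m) choose k)))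
      - (1 + q) * (q_Euler q (k + m + 1) / of_nat (k + m + 1))"
    by (simp add: G_def poly_binomial_antideriv_1 algebra_simps)
  finally show ?thesis .
qed

end
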